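(* Let $X$ be a doubly homogeneous linear order, witnessed by a doubly transitive $\ell$-permutation group $G$ acting on $X$, and let $d\ge1$. If $f:X^d\to X$ is invariant under $G$, then $f$ is a coordinate selector, i.e. $f(x_1,\ldots,x_d)\in\{x_1,\ldots,x_d\}$ for all $(x_1,\ldots,x_d)\in X^d$.
   Context: $X$ is a linearly ordered set with $|X|>2$. $\mathcal{A}(X)$ is the group of order-preserving bijections (automorphisms) of $X$, written on the right ($x\psi$), ordered pointwise; it is a lattice with pointwise meet and join. An $\ell$-permutation group is a subgroup $G$ of $\mathcal{A}(X)$ that is also a sublattice. $G$ is $m$-transitive if for all $x_1<\cdots<x_m$ and $y_1<\cdots<y_m$ in $X$ there exists $\psi\in G$ with $x_i\psi=y_i$ for all $i$; doubly transitive means $2$-transitive, and $X$ is doubly homogeneous if some doubly transitive $\ell$-permutation group acts on it. A function $f:X^d\to X$ is invariant (under $G$) if $f(x_1\psi,\ldots,x_d\psi)=f(x_1,\ldots,x_d)\psi$ for all $(x_1,\ldots,x_d)\in X^d$ and $\psi\in G$. *)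

theory Defs
  imports "HOL-Algebra.Group"
begin

(* Maps act on the right in the source, so the product of \<phi> and \<psi> is "first \<phi>, then \<psi>". *)
definition order_aut_group :: "('a::linorder \<Rightarrow> 'a) monoid" where
  "order_aut_group =
     \<lparr>carrier = {\<psi>. bij \<psi> \<and> strict_mono \<psi>}, monoid.mult = (\<lambda>\<phi> \<psi>. \<psi> \<circ> \<phi>), one = id\<rparr>"

lemma group_order_aut_group: "group (order_aut_group :: ('a::linorder \<Rightarrow> 'a) monoid)"
proof (rule groupI)
  fix \<phi> :: "'a \<Rightarrow> 'a"
  assume "\<phi> \<in> carrier order_aut_group"
  then have b: "bij \<phi>" and m: "strict_mono \<phi>"
    by (auto simp: order_aut_group_def)
  have "strict_mono (inv_into UNIV \<phi>)"
  proof (rule strict_monoI)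
    fix x y :: 'a
    assume "x < y"
    then have "\<phi> (inv_into UNIV \<phi> x) < \<phi> (inv_into UNIV \<phi> y)"
      using b by (simp add: bij_is_surj surj_f_inv_f)
    then show "inv_into UNIV \<phi> x < inv_into UNIV \<phi> y"
      using m by (simp add: strict_mono_less)
  qed
  moreover have "\<phi> \<circ> inv_into UNIV \<phi> = id"
    using b by (simp add: fun_eq_iff bij_is_surj surj_f_inv_f)
  ultimately show "\<exists>\<psi>\<in>carrier order_aut_group. \<psi> \<otimes>\<^bsub>order_aut_group\<^esub> \<phi> = \<one>\<^bsub>order_aut_group\<^esub>"
    using b by (intro bexI[of _ "inv_into UNIV \<phi>"]) (auto simp: order_aut_group_def bij_imp_bij_inv)
qed (auto simp: order_aut_group_def bij_comp strict_mono_def comp_assoc)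

lemma order_aut_group_pointwise_min_max:
  fixes \<phi> \<psi> :: "'a::linorder \<Rightarrow> 'a"
  assumes "\<phi> \<in> carrier order_aut_group" and "\<psi> \<in> carrier order_aut_group"
  shows "(\<lambda>x. min (\<phi> x) (\<psi> x)) \<in> carrier order_aut_group"
    and "(\<lambda>x. max (\<phi> x) (\<psi> x)) \<in> carrier order_aut_group"
proof -
  have b: "bij \<phi>" "bij \<psi>" and m: "strict_mono \<phi>" "strict_mono \<psi>"
    using assms by (auto simp: order_aut_group_def)
  have smin: "strict_mono (\<lambda>x. min (\<phi> x) (\<psi> x))"
    using m by (fastforce simp: strict_mono_def min_def)
  have smax: "strict_mono (\<lambda>x. max (\<phi> x) (\<psi> x))"
    using m by (fastforce simp: strict_mono_def max_def)
  have ex: "\<exists>u v. \<phi> u = y \<and> \<psi> v = y" for y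
    using b by (metis bij_pointE)
  have "\<exists>x. y = min (\<phi> x) (\<psi> x)" for y
  proof -
    obtain u v where uv: "\<phi> u = y" "\<psi> v = y" using ex by blast
    have "y \<le> \<phi> (max u v)" "y \<le> \<psi> (max u v)"
      using uv strict_mono_less_eq[OF m(1), of u _]
        strict_mono_less_eq[OF m(2), of v _] by force+
    moreover have "\<phi> (max u v) = y \<or> \<psi> (max u v) = y"
      using uv by (simp add: max_def)
    ultimately have "y = min (\<phi> (max u v)) (\<psi> (max u v))"
      by (auto simp: min_absorb1 min_absorb2)
    then show ?thesis by blast
  qed
  then have "surj (\<lambda>x. min (\<phi> x) (\<psi> x))" unfolding surj_def by blast
  then show "(\<lambda>x. min (\<phi> x) (\<psi> x)) \<in> carrier order_aut_group"
    using smin by (simp add: order_aut_group_def bij_def strict_mono_imp_inj_on)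
  have "\<exists>x. y = max (\<phi> x) (\<psi> x)" for y
  proof -
    obtain u v where uv: "\<phi> u = y" "\<psi> v = y" using ex by blast
    have "y \<ge> \<phi> (min u v)" "y \<ge> \<psi> (min u v)"
      using uv strict_mono_less_eq[OF m(1), of _ u]
        strict_mono_less_eq[OF m(2), of _ v] by force+
    moreover have "\<phi> (min u v) = y \<or> \<psi> (min u v) = y"
      using uv by (simp add: min_def)
    ultimately have "y = max (\<phi> (min u v)) (\<psi> (min u v))"
      by (auto simp: max_absorb1 max_absorb2)
    then show ?thesis by blast
  qed
  then have "surj (\<lambda>x. max (\<phi> x) (\<psi> x))" unfolding surj_def by blast
  then show "(\<lambda>x. max (\<phi> x) (\<psi> x)) \<in> carrier order_aut_group"
    using smax by (simp add: order_aut_group_def bij_def strict_mono_imp_inj_on)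
qed

definition l_permutation_group :: "('a::linorder \<Rightarrow> 'a) set \<Rightarrow> bool" where
  "l_permutation_group G \<longleftrightarrow>
     subgroup G order_aut_group \<and>
     (\<forall>\<phi>\<in>G. \<forall>\<psi>\<in>G. (\<lambda>x. min (\<phi> x) (\<psi> x)) \<in> G \<and> (\<lambda>x. max (\<phi> x) (\<psi> x)) \<in> G)"

definition m_transitive :: "nat \<Rightarrow> ('a::linorder \<Rightarrow> 'a) set \<Rightarrow> bool" where
  "m_transitive m G \<longleftrightarrow>
     (\<forall>xs ys. length xs = m \<and> length ys = m \<and> sorted_wrt (<) xs \<and> sorted_wrt (<) ys \<longrightarrow>
        (\<exists>\<psi>\<in>G. map \<psi> xs = ys))"

abbreviation doubly_transitive :: "('a::linorder \<Rightarrow> 'a) set \<Rightarrow> bool" where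
  "doubly_transitive \<equiv> m_transitive 2"

(* A d-ary function is a function on lists; only its values on lists of length d matter. *)
definition invariant_under :: "('a \<Rightarrow> 'a) set \<Rightarrow> nat \<Rightarrow> ('a list \<Rightarrow> 'a) \<Rightarrow> bool" where
  "invariant_under G d f \<longleftrightarrow>
     (\<forall>xs. length xs = d \<longrightarrow> (\<forall>\<psi>\<in>G. f (map \<psi> xs) = \<psi> (f xs)))"

definition coordinate_selector :: "nat \<Rightarrow> ('a list \<Rightarrow> 'a) \<Rightarrow> bool" where
  "coordinate_selector d f \<longleftrightarrow> (\<forall>xs. length xs = d \<longrightarrow> f xs \<in> set xs)"

end

theory Submission
  imports Defs
begin

text \<open>
  If \<open>y\<close> lies outside a finite nonempty set \<open>S\<close>, some member of \<open>G\<close> fixes \<open>S\<close> pointwise and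
  moves \<open>y\<close>; for an invariant \<open>f\<close> this excludes \<open>f xs = y\<close> with \<open>S = set xs\<close>. Double
  transitivity gives, for each single \<open>s \<noteq> y\<close>, a \<open>\<phi>\<close> in \<open>G\<close> with \<open>\<phi> s = s\<close> and \<open>\<phi> y > y\<close>.
  The pointwise minimum of these maps over \<open>s \<in> S\<close> still raises \<open>y\<close> and raises no point of \<open>S\<close>,
  so its pointwise maximum with the identity fixes \<open>S\<close> and moves \<open>y\<close>.
\<close>

text \<open>\<open>card\<close> of an infinite type is 0, so the infinite case of |X| > 2 is a
  separate disjunct.\<close>

lemma ex_three_increasing:
  assumes "infinite (UNIV :: 'a::linorder set) \<or> card (UNIV :: 'a set) > 2"
  shows "\<exists>a b c :: 'a. a < b \<and> b < c"
proof -
  obtain T :: "'a set" where "card T = 3"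
    using assms infinite_arbitrarily_large[of "UNIV :: 'a set" 3]
      obtain_subset_with_card_n[of 3 "UNIV :: 'a set"] by fastforce
  then obtain x y z :: 'a where "x \<noteq> y" "x \<noteq> z" "y \<noteq> z"
    by (auto simp: card_3_iff)
  then show ?thesis by (metis linorder_less_linear)
qed

lemma l_permutation_group_strict_mono:
  assumes "l_permutation_group G" and "\<phi> \<in> G"
  shows "strict_mono \<phi>"
proof -
  have "G \<subseteq> carrier order_aut_group"
    using assms(1) by (simp add: l_permutation_group_def subgroup.subset)
  with assms(2) show ?thesis by (auto simp: order_aut_group_def)
qed

lemma l_permutation_group_id:
  assumes "l_permutation_group G"
  shows "id \<in> G"
  using assms subgroup.one_closed[of G order_aut_group]
  by (simp add: l_permutation_group_def order_aut_group_def)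

lemma doubly_transitiveD:
  assumes "doubly_transitive G" and "x < y" and "u < v"
  shows "\<exists>\<phi>\<in>G. \<phi> x = u \<and> \<phi> y = v"
proof -
  have "\<exists>\<phi>\<in>G. map \<phi> [x, y] = [u, v]"
    using assms unfolding m_transitive_def
    by (elim allE[where x = "[x, y]"] allE[where x = "[u, v]"]) simp
  then show ?thesis by simp
qed

context
  fixes G :: "('a::linorder \<Rightarrow> 'a) set"
  assumes card: "infinite (UNIV :: 'a set) \<or> card (UNIV :: 'a set) > 2"
    and lgroup: "l_permutation_group G"
    and trans: "doubly_transitive G"
begin

text \<open>One pair a < c has a point b between; carrying (a, c) to (x, y) puts the image of b
  between x and y.\<close>

lemma doubly_homogeneous_dense:
  assumes "x < (y :: 'a)"
  shows "\<exists>z. x < z \<and> z < y"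
proof -
  obtain a b c :: 'a where abc: "a < b" "b < c"
    using ex_three_increasing[OF card] by blast
  then obtain \<phi> where \<phi>: "\<phi> \<in> G" "\<phi> a = x" "\<phi> c = y"
    using doubly_transitiveD[OF trans less_trans[OF abc] assms] by blast
  then show ?thesis
    using abc l_permutation_group_strict_mono[OF lgroup \<phi>(1)] by (metis strict_mono_less)
qed

lemma doubly_homogeneous_no_top: "\<exists>z. (y :: 'a) < z"
proof -
  obtain a b c :: 'a where abc: "a < b" "b < c"
    using ex_three_increasing[OF card] by blast
  show ?thesis
  proof (cases "\<exists>x. x < y")
    case True
    then obtain x where "x < y" by blast
    then obtain \<phi> where \<phi>: "\<phi> \<in> G" "\<phi> b = y"
      using doubly_transitiveD[OF trans abc(1)] by blast
    then have "y < \<phi> c"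
      using abc l_permutation_group_strict_mono[OF lgroup \<phi>(1)] by (metis strict_mono_less)
    then show ?thesis by blast
  next
    \<comment> \<open>Here y is the least element, so y \<le> a < b.\<close>
    case False
    then show ?thesis using abc by (metis linorder_less_linear)
  qed
qed

text \<open>Move the pair formed by s and y to the one formed by s and z, where z > y lies on the
  same side of s as y; the absence of a top or density supplies z.\<close>

lemma fix_point_raise_point:
  assumes "s \<noteq> (y :: 'a)"
  shows "\<exists>\<phi>\<in>G. y < \<phi> y \<and> \<phi> s = s"
proof (cases "s < y")
  case True
  obtain z where "y < z" using doubly_homogeneous_no_top by blast
  with True show ?thesis
    using doubly_transitiveD[OF trans True less_trans[OF True \<open>y < z\<close>]] by auto
next
  case False
  with assms have "y < s" by simp
  moreover obtain z where "y < z" "z < s"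
    using doubly_homogeneous_dense[OF \<open>y < s\<close>] by blast
  ultimately show ?thesis
    using doubly_transitiveD[OF trans, of y s z s] by auto
qed

text \<open>Induction on S by pointwise minima. Only \<le> is claimed on S, since a map fixing one
  point may lower another.\<close>

lemma lower_finite_raise_point:
  assumes "finite S" and "S \<noteq> {}" and "(y :: 'a) \<notin> S"
  shows "\<exists>\<phi>\<in>G. y < \<phi> y \<and> (\<forall>s\<in>S. \<phi> s \<le> s)"
  using assms
proof (induction S rule: finite_ne_induct)
  case (singleton s)
  then show ?case using fix_point_raise_point[of s y] by auto
next
  case (insert s S)
  then obtain \<phi> where \<phi>: "\<phi> \<in> G" "y < \<phi> y" "\<forall>t\<in>S. \<phi> t \<le> t" by auto
  obtain \<psi> where \<psi>: "\<psi> \<in> G" "y < \<psi> y" "\<psi> s = s"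
    using fix_point_raise_point[of s y] insert.prems by auto
  have "(\<lambda>x. min (\<phi> x) (\<psi> x)) \<in> G"
    using lgroup \<phi>(1) \<psi>(1) by (simp add: l_permutation_group_def)
  then show ?case
    using \<phi> \<psi> by (intro bexI[of _ "\<lambda>x. min (\<phi> x) (\<psi> x)"]) (auto simp: min.coboundedI1)
qed

lemma fix_finite_move_point:
  assumes "finite S" and "S \<noteq> {}" and "(y :: 'a) \<notin> S"
  shows "\<exists>\<phi>\<in>G. \<phi> y \<noteq> y \<and> (\<forall>s\<in>S. \<phi> s = s)"
proof -
  obtain \<phi> where \<phi>: "\<phi> \<in> G" "y < \<phi> y" "\<forall>s\<in>S. \<phi> s \<le> s"
    using lower_finite_raise_point[OF assms] by blast
  have "(\<lambda>x. max (\<phi> x) (id x)) \<in> G"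
    using lgroup \<phi>(1) l_permutation_group_id[OF lgroup] unfolding l_permutation_group_def by blast
  then show ?thesis
    using \<phi> by (intro bexI[of _ "\<lambda>x. max (\<phi> x) (id x)"]) (auto simp: max_def)
qed

end

theorem theorem7:
  fixes G :: "('a::linorder \<Rightarrow> 'a) set"
    and d :: nat
    and f :: "'a list \<Rightarrow> 'a"
  assumes "infinite (UNIV :: 'a set) \<or> card (UNIV :: 'a set) > 2"
    and "l_permutation_group G"
    and "doubly_transitive G"
    and "d \<ge> 1"
    and "invariant_under G d f"
  shows "coordinate_selector d f"
  unfolding coordinate_selector_def
proof (intro allI impI)
  fix xs :: "'a list"
  assume len: "length xs = d"
  show "f xs \<in> set xs"
  proof (rule ccontr)
    assume "f xs \<notin> set xs"
    \<comment> \<open>\<open>d \<ge> 1\<close> supplies the point from which the induction over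
      \<open>set xs\<close> starts.\<close>
    moreover have "set xs \<noteq> {}" using len assms(4) by auto
    ultimately obtain \<phi> where \<phi>: "\<phi> \<in> G" "\<phi> (f xs) \<noteq> f xs" "\<forall>s\<in>set xs. \<phi> s = s"
      using fix_finite_move_point[OF assms(1-3), of "set xs"] by auto
    have "\<phi> (f xs) = f (map \<phi> xs)"
      using assms(5) len \<phi>(1) by (simp add: invariant_under_def)
    also have "map \<phi> xs = xs"
      using \<phi>(3) by (simp add: map_idI)
    finally show False using \<phi>(2) by simp
  qed
qed

end
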